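(* Let $a>0$ and $\kappa>0$ be real numbers. Suppose that for all $t\ge 0$ one has $$J_0(t)+J_0(\kappa t)+J_0((1+\kappa)t)>-1 .$$ Then for any measurable coloring of the plane $\mathbb{R}^2$ into two colors there is a monochromatic collinear triple $\{x,y,z\}$ such that $y\in[x,z]$ and $\|y-x\|=a$, $\|z-y\|=\kappa a$.
   Context: $\|\cdot\|$ is the Euclidean norm on $\mathbb{R}^2$ and $[x,z]$ is the closed segment with endpoints $x,z$. A measurable coloring of $\mathbb{R}^2$ into two colors is a partition of $\mathbb{R}^2$ into two disjoint Lebesgue measurable sets (the colors). A triple is monochromatic if all its points belong to the same color. $J_0$ is the zeroth Bessel function of the first kind, $J_0(z)=\sum_{k=0}^{\infty}\frac{(-1)^k (z/2)^{2k}}{(k!)^2}$. *)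

theory Defs
  imports "HOL-Analysis.Analysis"
begin

definition bessel_J0 :: "real \<Rightarrow> real" where
  "bessel_J0 z = (\<Sum>k. (-1) ^ k * (z / 2) ^ (2 * k) / (fact k)\<^sup>2)"

lemma summable_bessel_J0:
  "summable (\<lambda>k. (-1) ^ k * (z / 2) ^ (2 * k) / (fact k :: real)\<^sup>2)"
proof (rule summable_comparison_test')
  show "summable (\<lambda>k. inverse (fact k) * ((z / 2)\<^sup>2) ^ k)"
    by (rule summable_exp)
  show "norm ((-1) ^ k * (z / 2) ^ (2 * k) / (fact k :: real)\<^sup>2)
      \<le> inverse (fact k) * ((z / 2)\<^sup>2) ^ k" if "k \<ge> 0" for k
  proof -
    have "(fact k :: real) * 1 \<le> fact k * fact k"
      by (intro mult_left_mono) (simp_all add: fact_ge_1)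
    then have "(fact k :: real) \<le> (fact k)\<^sup>2"
      by (simp only: power2_eq_square mult_1_right)
    then have le: "((z / 2)\<^sup>2) ^ k / (fact k)\<^sup>2 \<le> ((z / 2)\<^sup>2) ^ k / fact k"
      by (intro divide_left_mono) auto
    have "norm ((-1) ^ k * (z / 2) ^ (2 * k) / (fact k :: real)\<^sup>2)
        = ((z / 2)\<^sup>2) ^ k / (fact k)\<^sup>2"
      by (simp add: abs_mult power_abs power_mult power_divide)
    with le show ?thesis
      by (simp only: divide_inverse mult.commute)
  qed
qed

text \<open>A color class may be empty.\<close>

definition measurable_two_coloring :: "'a::euclidean_space set \<Rightarrow> 'a set \<Rightarrow> bool" where
  "measurable_two_coloring A B \<longleftrightarrow>
     A \<in> sets lebesgue \<and> B \<in> sets lebesgue \<and> A \<union> B = UNIV \<and> A \<inter> B = {}"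

definition monochromatic :: "'a set \<Rightarrow> 'a set \<Rightarrow> 'a set \<Rightarrow> bool" where
  "monochromatic A B T \<longleftrightarrow> T \<subseteq> A \<or> T \<subseteq> B"

end

theory Submission
  imports Defs "HOL-Probability.Characteristic_Functions"
begin

text \<open>
  Suppose that no such monochromatic triple exists, and let \<open>f\<close> be \<open>1\<close> on \<open>A\<close> and \<open>-1\<close> on \<open>B\<close>. Three
  signs that are not all equal have pairwise products summing to \<open>-1\<close>. Hence, for every unit vector
  \<open>u\<close>, the average over \<open>x\<close> of \<open>f x * f (x + v)\<close>, summed over \<open>v = a u\<close>, \<open>v = \<kappa> a u\<close> and
  \<open>v = (1 + \<kappa>) a u\<close>, equals \<open>-1\<close>. On the other hand the average as a function of \<open>v\<close> is positive
  definite with value \<open>1\<close> at \<open>v = 0\<close>, so it is a mixture of the functions \<open>cos (\<eta> \<bullet> v)\<close>. Averaging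
  \<open>cos (\<eta> \<bullet> r u)\<close> over the direction \<open>u\<close> gives \<open>J0 (r * norm \<eta>)\<close>, so the number \<open>-1\<close> would be a
  mixture of values \<open>J0 t + J0 (\<kappa> t) + J0 ((1 + \<kappa>) t)\<close>, all of which exceed \<open>-1\<close>.

  To avoid averages over the whole plane, \<open>f\<close> is cut off to a cube of side length \<open>2 R\<close>, and averages
  become the autocorrelation integrals \<open>autocorr f v\<close>. The cut-off costs an error of order \<open>R\<close>
  against a main term of order \<open>R\<^sup>2\<close> (\<open>autocorr_triple_le\<close>). To absorb it one needs a gap: the
  Bessel sum is at least \<open>-1 + \<epsilon>\<close> for some fixed \<open>\<epsilon> > 0\<close>. It exists because \<open>J0\<close> is continuous
  and tends to \<open>0\<close> at infinity (\<open>bessel_J0_tendsto_0\<close>), which follows from the monotonicity of an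
  energy for Bessel's equation.

  Positive definiteness enters in the form \<open>autocorr_average_nonneg\<close>: an autocorrelation integrates
  nonnegatively against every signed measure with nonnegative Fourier transform. Smearing the
  autocorrelation by a narrow Gaussian turns the claim into an exact Fubini identity involving the
  manifestly nonnegative power spectrum. The smearing is undone in the limit because the
  autocorrelation is continuous (\<open>continuous_on_autocorr\<close>), which is the \<open>L\<^sup>1\<close>-continuity of
  translations of bounded measurable sets.
\<close>

section \<open>The Gaussian and its Fourier transform\<close>

text \<open>The density of the standard normal distribution on an arbitrary Euclidean space.\<close>

definition std_gauss :: "'a::euclidean_space \<Rightarrow> real" where
  "std_gauss x = exp (- (norm x)\<^sup>2 / 2) / sqrt (2 * pi) ^ DIM('a)"

lemma std_gauss_pos: "std_gauss x > 0"
  by (simp add: std_gauss_def)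

lemma std_gauss_measurable [measurable]: "std_gauss \<in> borel_measurable borel"
  unfolding std_gauss_def by measurable

lemma std_gauss_eq_prod:
  "std_gauss x = (\<Prod>b\<in>Basis. std_normal_density (x \<bullet> b))"
  for x :: "'a::euclidean_space"
proof -
  have "exp (- (norm x)\<^sup>2 / 2) = (\<Prod>b\<in>Basis. exp (- (x \<bullet> b)\<^sup>2 / 2))"
    unfolding power2_norm_eq_inner euclidean_inner[of x x]
    by (simp add: exp_sum[symmetric] sum_negf sum_divide_distrib power2_eq_square)
  then show ?thesis
    by (simp add: std_gauss_def std_normal_density_def prod_dividef)
qed

text \<open>Lebesgue measure on a Euclidean space is the product of its coordinate copies, so functions
  that split over the coordinates integrate factor by factor. This reduces every Gaussian
  computation below to dimension one.\<close>

lemma integral_lborel_prod: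
  fixes f :: "'a::euclidean_space \<Rightarrow> real \<Rightarrow> 'b::{real_normed_field,banach,second_countable_topology}"
  assumes "\<And>b. b \<in> Basis \<Longrightarrow> integrable lborel (f b)"
  shows "integrable lborel (\<lambda>x. \<Prod>b\<in>Basis. f b (x \<bullet> b))"
    and "(LINT x|lborel. (\<Prod>b\<in>Basis. f b (x \<bullet> b))) = (\<Prod>b\<in>Basis. LINT t|lborel. f b t)"
proof -
  interpret product_sigma_finite "\<lambda>_::'a. lborel::real measure" ..
  have [measurable]: "f b \<in> borel_measurable borel" if "b \<in> Basis" for b
    using assms[OF that] by (simp add: borel_measurable_integrable)
  have eq: "(\<Prod>b\<in>Basis. f b ((\<Sum>c\<in>Basis. y c *\<^sub>R c) \<bullet> b)) = (\<Prod>b\<in>Basis. f b (y b))" for y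
    by (intro prod.cong) auto
  show "integrable lborel (\<lambda>x. \<Prod>b\<in>Basis. f b (x \<bullet> b))"
    by (subst lborel_eq) (simp add: integrable_distr_eq eq product_integrable_prod assms)
  show "(LINT x|lborel. (\<Prod>b\<in>Basis. f b (x \<bullet> b))) = (\<Prod>b\<in>Basis. LINT t|lborel. f b t)"
    by (subst lborel_eq) (simp add: integral_distr eq product_integral_prod assms)
qed

lemma
  shows std_gauss_integrable: "integrable lborel (std_gauss :: 'a::euclidean_space \<Rightarrow> real)"
    and std_gauss_integral: "(LINT x|lborel. std_gauss (x::'a)) = 1"
  using integral_lborel_prod[where f = "\<lambda>_::'a. std_normal_density"]
  by (simp_all add: std_gauss_eq_prod[abs_def])

lemma std_normal_fourier:
  "integrable lborel (\<lambda>x. of_real (std_normal_density x) * cis (t * x))"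
  "(LINT x|lborel. of_real (std_normal_density x) * cis (t * x)) = of_real (exp (- t\<^sup>2 / 2))"
proof -
  show "integrable lborel (\<lambda>x. of_real (std_normal_density x) * cis (t * x))"
    by (rule Bochner_Integration.integrable_bound[OF integrable_normal_density[of 1 0]])
       (auto simp: norm_mult cis_conv_exp)
  have "char std_normal_distribution t = (LINT x|lborel. of_real (std_normal_density x) * cis (t * x))"
    unfolding char_def by (subst integral_density) (auto simp: cis_conv_exp scaleR_conv_of_real)
  then show "(LINT x|lborel. of_real (std_normal_density x) * cis (t * x)) = of_real (exp (- t\<^sup>2 / 2))"
    by (simp add: char_std_normal_distribution)
qed

text \<open>Both the density and the character split over the coordinates, and in each coordinate the
  integral is the characteristic function of the standard normal distribution.\<close>

lemma std_gauss_fourier: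
  fixes \<eta> :: "'a::euclidean_space"
  shows "(LINT x|lborel. of_real (std_gauss x) * cis (\<eta> \<bullet> x)) = of_real (exp (- (norm \<eta>)\<^sup>2 / 2))"
proof -
  have cis_sum: "cis (sum F A) = (\<Prod>b\<in>A. cis (F b))" if "finite A" for F and A :: "'a set"
    using that by (induction A rule: finite_induct) (auto simp: cis_mult[symmetric])
  have "of_real (std_gauss x) * cis (\<eta> \<bullet> x)
      = (\<Prod>b\<in>Basis. of_real (std_normal_density (x \<bullet> b)) * cis ((\<eta> \<bullet> b) * (x \<bullet> b)))" for x
    by (subst euclidean_inner) (simp add: std_gauss_eq_prod cis_sum prod.distrib)
  then have "(LINT x|lborel. of_real (std_gauss x) * cis (\<eta> \<bullet> x))
      = (\<Prod>b\<in>(Basis::'a set). of_real (exp (- (\<eta> \<bullet> b)\<^sup>2 / 2)))"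
    using std_normal_fourier
    by (simp only:) (subst integral_lborel_prod, auto)
  also have "\<dots> = of_real (exp (- (norm \<eta>)\<^sup>2 / 2))"
    unfolding power2_norm_eq_inner euclidean_inner[of \<eta> \<eta>]
    by (simp add: exp_sum[symmetric] sum_negf sum_divide_distrib power2_eq_square flip: of_real_prod)
  finally show ?thesis .
qed

section \<open>Autocorrelations are positive definite\<close>

lemma lborel_integral_shift:
  fixes F :: "'a::euclidean_space \<Rightarrow> 'b::{banach,second_countable_topology}"
  assumes [measurable]: "F \<in> borel_measurable borel"
  shows "(LINT x|lborel. F (v + x)) = (LINT x|lborel. F x)"
  by (subst (2) lborel_distr_plus[of v, symmetric]) (simp add: integral_distr)

lemma lborel_integrable_shift:
  fixes F :: "'a::euclidean_space \<Rightarrow> 'b::{banach,second_countable_topology}"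
  assumes "integrable lborel F"
  shows "integrable lborel (\<lambda>x. F (v + x))"
proof -
  have [measurable]: "F \<in> borel_measurable borel" using assms by (simp add: borel_measurable_integrable)
  show ?thesis using assms
  by (subst (asm) lborel_distr_plus[of v, symmetric]) (simp add: integrable_distr_eq)
qed

definition autocorr :: "('a::euclidean_space \<Rightarrow> real) \<Rightarrow> 'a \<Rightarrow> real" where
  "autocorr f v = (LINT x|lborel. f x * f (x + v))"

definition fourier :: "('a::euclidean_space \<Rightarrow> real) \<Rightarrow> 'a \<Rightarrow> complex" where
  "fourier f \<eta> = (LINT x|lborel. of_real (f x) * cis (\<eta> \<bullet> x))"

text \<open>These two majorants justify the applications of Fubini's theorem on \<open>lborel \<Otimes>\<^sub>M lborel\<close>: a
  product for the Gaussian times an autocorrelation, a sheared product for the integrand of an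
  autocorrelation itself.\<close>

lemma pair_integrableI:
  fixes F :: "'a::euclidean_space \<times> 'b::euclidean_space \<Rightarrow> 'c::{banach,second_countable_topology}"
  assumes [measurable]: "F \<in> borel_measurable (borel \<Otimes>\<^sub>M borel)"
   and "integrable lborel p" "integrable lborel q"
   and "\<And>x y. norm (F (x,y)) \<le> norm (p x * q y :: real)"
  shows "integrable (lborel \<Otimes>\<^sub>M lborel) F"
proof -
  have [measurable]: "p \<in> borel_measurable borel" "q \<in> borel_measurable borel"
    using assms by (simp_all add: borel_measurable_integrable)
  have "integrable (lborel \<Otimes>\<^sub>M lborel) (\<lambda>(x,y). p x * q y)"
    using assms by (intro lborel_pair.Fubini_integrable) (auto simp: abs_mult)
  then show ?thesis
    by (rule Bochner_Integration.integrable_bound) (use assms in auto)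
qed

lemma pair_shear_integrableI:
  fixes F :: "'a::euclidean_space \<times> 'a \<Rightarrow> 'c::{banach,second_countable_topology}"
  assumes [measurable]: "F \<in> borel_measurable (borel \<Otimes>\<^sub>M borel)"
   and "integrable lborel p" "integrable lborel q"
   and "\<And>x y. norm (F (x,y)) \<le> norm (p x * q (x + y) :: real)"
  shows "integrable (lborel \<Otimes>\<^sub>M lborel) F"
proof -
  have [measurable]: "p \<in> borel_measurable borel" "q \<in> borel_measurable borel"
    using assms by (simp_all add: borel_measurable_integrable)
  have "integrable (lborel \<Otimes>\<^sub>M lborel) (\<lambda>(x,y). p x * q (x + y))"
    using assms lborel_integrable_shift[of q] lborel_integral_shift[of "\<lambda>x. \<bar>q x\<bar>"]
    by (intro lborel_pair.Fubini_integrable) (auto simp: abs_mult)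
  then show ?thesis
    by (rule Bochner_Integration.integrable_bound) (use assms in auto)
qed

context
  fixes f :: "'a::euclidean_space \<Rightarrow> real"
  assumes int_f: "integrable lborel f" and f_le_1: "\<And>x. \<bar>f x\<bar> \<le> 1"
begin

lemma f_measurable [measurable]: "f \<in> borel_measurable borel"
  using int_f by (simp add: borel_measurable_integrable)

lemma integrable_autocorr_integrand: "integrable lborel (\<lambda>x. f x * f (x + v))"
  by (rule Bochner_Integration.integrable_bound[OF int_f])
     (auto simp: abs_mult intro!: mult_left_le f_le_1)

lemma integrable_autocorr: "integrable lborel (autocorr f)"
proof -
  have "integrable (lborel \<Otimes>\<^sub>M lborel) (\<lambda>(x, v). f x * f (x + v))"
    by (rule pair_shear_integrableI[OF _ int_f int_f]) auto
  then show ?thesis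
    unfolding autocorr_def by (rule lborel_pair.integrable_snd)
qed

lemma autocorr_measurable [measurable]: "autocorr f \<in> borel_measurable borel"
  using integrable_autocorr by (simp add: borel_measurable_integrable)

lemma fourier_measurable [measurable]: "fourier f \<in> borel_measurable borel"
  unfolding fourier_def cis_conv_exp by measurable

text \<open>The Fourier transform of the autocorrelation is the power spectrum: substituting
  \<open>y = x + w\<close> in the double integral separates it into the product of \<open>fourier f \<eta>\<close> and its
  conjugate. The shift by \<open>v\<close> only contributes a phase.\<close>

lemma fourier_autocorr:
  "(LINT w|lborel. of_real (autocorr f w) * cis (\<eta> \<bullet> (w - v)))
     = of_real ((cmod (fourier f \<eta>))\<^sup>2) * cis (- (\<eta> \<bullet> v))"
proof -
  let ?G = "\<lambda>x w. complex_of_real (f x * f (x + w)) * cis (\<eta> \<bullet> (w - v))"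
  have int: "integrable (lborel \<Otimes>\<^sub>M lborel) (\<lambda>(x, w). ?G x w)"
    unfolding cis_conv_exp
    by (rule pair_shear_integrableI[OF _ int_f int_f]) (auto simp: norm_mult)
  have "(LINT w|lborel. of_real (autocorr f w) * cis (\<eta> \<bullet> (w - v)))
      = (LINT w|lborel. LINT x|lborel. ?G x w)"
    unfolding autocorr_def by (simp flip: integral_complex_of_real)
  also have "\<dots> = (LINT x|lborel. LINT w|lborel. ?G x w)"
    by (rule lborel_pair.Fubini_integral[OF int])
  also have "\<dots> = (LINT x|lborel. of_real (f x) * cis (- (\<eta> \<bullet> x)) * cis (- (\<eta> \<bullet> v)) * fourier f \<eta>)"
  proof (rule Bochner_Integration.integral_cong)
    fix x
    let ?K = "\<lambda>y. of_real (f x) * cis (- (\<eta> \<bullet> x)) * cis (- (\<eta> \<bullet> v)) * (complex_of_real (f y) * cis (\<eta> \<bullet> y))"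
    have "?G x w = ?K (x + w)" for w
      by (simp add: cis_mult inner_diff_right inner_add_right algebra_simps)
    then have "(LINT w|lborel. ?G x w) = (LINT w|lborel. ?K (x + w))"
      by (simp only:)
    also have "\<dots> = (LINT y|lborel. ?K y)"
      unfolding cis_conv_exp by (rule lborel_integral_shift) measurable
    finally show "(LINT w|lborel. ?G x w) = of_real (f x) * cis (- (\<eta> \<bullet> x)) * cis (- (\<eta> \<bullet> v)) * fourier f \<eta>"
      by (simp add: fourier_def)
  qed simp
  also have "\<dots> = (LINT x|lborel. cnj (of_real (f x) * cis (\<eta> \<bullet> x))) * cis (- (\<eta> \<bullet> v)) * fourier f \<eta>"
    by (simp add: cis_cnj)
  also have "\<dots> = cnj (fourier f \<eta>) * fourier f \<eta> * cis (- (\<eta> \<bullet> v))"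
    by (simp add: fourier_def del: complex_cnj_mult)
  finally show ?thesis
    by (simp only: complex_norm_square mult.commute[of "cnj _"])
qed

text \<open>A Gaussian average of the autocorrelation around \<open>v\<close>, at scale \<open>1 / s\<close>, is a Gaussian average of
  the power spectrum at scale \<open>s\<close>, twisted by \<open>v\<close>: the Gaussian is its own Fourier transform.
  The regularisation makes all double integrals absolutely convergent, so that Fubini's theorem
  can stand in for Fourier inversion.\<close>

lemma gauss_autocorr:
  fixes v :: 'a
  assumes s: "s > 0"
  shows "(LINT z|lborel. std_gauss z * autocorr f (v + (1 / s) *\<^sub>R z))
    = (s / sqrt (2 * pi)) ^ DIM('a)
       * (LINT \<xi>|lborel. std_gauss \<xi> * (cmod (fourier f (s *\<^sub>R \<xi>)))\<^sup>2 * cos (s *\<^sub>R \<xi> \<bullet> v))"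
proof -
  let ?G = "\<lambda>\<xi> w. complex_of_real (std_gauss \<xi> * autocorr f w) * cis (s *\<^sub>R \<xi> \<bullet> (w - v))"
  have int: "integrable (lborel \<Otimes>\<^sub>M lborel) (\<lambda>(\<xi>, w). ?G \<xi> w)"
    unfolding cis_conv_exp
    by (rule pair_integrableI[OF _ std_gauss_integrable integrable_autocorr]) (auto simp: norm_mult)
  (* Integrating over w first produces the power spectrum; integrating over \<xi> first produces a
     Gaussian in w. *)
  have 1: "(LINT w|lborel. ?G \<xi> w)
      = complex_of_real (std_gauss \<xi> * (cmod (fourier f (s *\<^sub>R \<xi>)))\<^sup>2) * cis (- (s *\<^sub>R \<xi> \<bullet> v))" for \<xi>
    using fourier_autocorr[of "s *\<^sub>R \<xi>" v] by (simp add: mult.assoc)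
  have 2: "(LINT \<xi>|lborel. ?G \<xi> w)
      = complex_of_real (autocorr f w * exp (- (norm (s *\<^sub>R (w - v)))\<^sup>2 / 2))" for w
  proof -
    have "(LINT \<xi>|lborel. ?G \<xi> w)
       = (LINT \<xi>|lborel. of_real (autocorr f w) * (of_real (std_gauss \<xi>) * cis ((s *\<^sub>R (w - v)) \<bullet> \<xi>)))"
      by (intro Bochner_Integration.integral_cong) (auto simp: inner_commute)
    then show ?thesis by (simp only: integral_mult_right_zero std_gauss_fourier) simp
  qed
  have "(LINT \<xi>|lborel. complex_of_real (std_gauss \<xi> * (cmod (fourier f (s *\<^sub>R \<xi>)))\<^sup>2) * cis (- (s *\<^sub>R \<xi> \<bullet> v)))
      = complex_of_real (LINT w|lborel. autocorr f w * exp (- (norm (s *\<^sub>R (w - v)))\<^sup>2 / 2))"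
    using lborel_pair.Fubini_integral[OF int]
    unfolding 1 2 integral_complex_of_real by (rule sym)
  then have "Re (LINT \<xi>|lborel. complex_of_real (std_gauss \<xi> * (cmod (fourier f (s *\<^sub>R \<xi>)))\<^sup>2) * cis (- (s *\<^sub>R \<xi> \<bullet> v)))
      = (LINT w|lborel. autocorr f w * exp (- (norm (s *\<^sub>R (w - v)))\<^sup>2 / 2))"
    by simp
  moreover have "integrable lborel (\<lambda>\<xi>. complex_of_real (std_gauss \<xi> * (cmod (fourier f (s *\<^sub>R \<xi>)))\<^sup>2) * cis (- (s *\<^sub>R \<xi> \<bullet> v)))"
    using lborel_pair.integrable_fst[OF int] unfolding 1 .
  ultimately have "(LINT \<xi>|lborel. std_gauss \<xi> * (cmod (fourier f (s *\<^sub>R \<xi>)))\<^sup>2 * cos (s *\<^sub>R \<xi> \<bullet> v))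
      = (LINT w|lborel. autocorr f w * exp (- (norm (s *\<^sub>R (w - v)))\<^sup>2 / 2))"
    by (subst (asm) integral_Re[symmetric]) auto
  also have "\<dots> = (LINT z|lborel. (1 / s) ^ DIM('a) * (autocorr f (v + (1 / s) *\<^sub>R z) * exp (- (norm z)\<^sup>2 / 2)))"
    using s by (subst lborel_affine[of "1 / s" v])
      (auto simp: integral_density integral_distr)
  also have "\<dots> = (sqrt (2 * pi) / s) ^ DIM('a) * (LINT z|lborel. std_gauss z * autocorr f (v + (1 / s) *\<^sub>R z))"
    unfolding integral_mult_right_zero[symmetric]
    by (intro Bochner_Integration.integral_cong) (auto simp: std_gauss_def power_divide power_mult_distrib)
  finally show ?thesis
    using s by (simp add: power_divide)
qed

lemma autocorr_le: "\<bar>autocorr f v\<bar> \<le> (LINT x|lborel. \<bar>f x\<bar>)"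
  unfolding autocorr_def
  by (rule order_trans[OF integral_abs_bound])
     (auto simp: abs_mult intro!: integral_mono mult_left_le f_le_1
        integrable_autocorr_integrand[THEN integrable_abs, unfolded abs_mult] int_f)

text \<open>Rescaled Gaussians form an approximate identity.\<close>

lemma gauss_autocorr_tendsto:
  assumes cont: "continuous_on UNIV (autocorr f)"
  shows "(\<lambda>n. LINT z|lborel. std_gauss z * autocorr f (v + (1 / real (Suc n)) *\<^sub>R z))
           \<longlonglongrightarrow> autocorr f v"
proof -
  have "(\<lambda>n. LINT z|lborel. std_gauss z * autocorr f (v + (1 / real (Suc n)) *\<^sub>R z))
          \<longlonglongrightarrow> (LINT z|lborel. std_gauss (z::'a) * autocorr f v)"
  proof (rule integral_dominated_convergence[where w = "\<lambda>z. std_gauss z * (LINT x|lborel. \<bar>f x\<bar>)"])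
    show "AE z in lborel. (\<lambda>n. std_gauss z * autocorr f (v + (1 / real (Suc n)) *\<^sub>R z))
        \<longlonglongrightarrow> std_gauss z * autocorr f v"
    proof (intro AE_I2 tendsto_mult tendsto_const)
      fix z
      have "(\<lambda>n. v + (1 / real (Suc n)) *\<^sub>R z) \<longlonglongrightarrow> v + 0 *\<^sub>R z"
        using LIMSEQ_inverse_real_of_nat
        by (intro tendsto_intros) (simp add: inverse_eq_divide)
      then show "(\<lambda>n. autocorr f (v + (1 / real (Suc n)) *\<^sub>R z)) \<longlonglongrightarrow> autocorr f v"
        using cont by (intro isCont_tendsto_compose[of v "autocorr f"])
          (auto simp: continuous_on_eq_continuous_at)
    qed
  qed (auto simp: abs_mult std_gauss_integrable std_gauss_pos less_imp_le autocorr_le intro!: mult_left_mono)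
  then show ?thesis
    by (simp add: std_gauss_integral)
qed

lemma cmod_fourier_le: "cmod (fourier f \<eta>) \<le> (LINT x|lborel. \<bar>f x\<bar>)"
  unfolding fourier_def by (rule order_trans[OF integral_norm_bound]) (simp add: norm_mult)

lemma integrable_autocorr_family:
  assumes "finite_measure M" and [measurable]: "V \<in> borel_measurable M"
  shows "integrable M (\<lambda>\<omega>. autocorr f (V \<omega>))"
proof -
  interpret finite_measure M by fact
  show ?thesis
    by (rule integrable_const_bound[where B = "LINT x|lborel. \<bar>f x\<bar>"]) (simp_all add: autocorr_le)
qed

lemma integrable_twisted_power_spectrum:
  fixes V :: "'b \<Rightarrow> 'a"
  assumes "finite_measure M" and [measurable]: "V \<in> borel_measurable M"
  shows "integrable (lborel \<Otimes>\<^sub>M M) (\<lambda>(\<xi>, \<omega>).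
           std_gauss \<xi> * (cmod (fourier f (s *\<^sub>R \<xi>)))\<^sup>2 * cos (s *\<^sub>R \<xi> \<bullet> V \<omega>))"
proof -
  interpret finite_measure M by fact
  interpret pair_sigma_finite "lborel :: 'a measure" M ..
  let ?L = "LINT x|lborel. \<bar>f x\<bar>"
  let ?G = "\<lambda>\<xi> \<omega>. std_gauss \<xi> * (cmod (fourier f (s *\<^sub>R \<xi>)))\<^sup>2 * cos (s *\<^sub>R \<xi> \<bullet> V \<omega>)"
  show ?thesis
  proof (rule Bochner_Integration.integrable_bound)
    show "integrable (lborel \<Otimes>\<^sub>M M) (\<lambda>(\<xi>, \<omega>). std_gauss (\<xi>::'a) * ?L\<^sup>2)"
      using std_gauss_integrable by (intro Fubini_integrable) (auto simp: abs_mult)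
    have "norm (?G \<xi> \<omega>) \<le> std_gauss \<xi> * ?L\<^sup>2 * 1" for \<xi> \<omega>
      unfolding norm_mult
      by (intro mult_mono) (auto simp: std_gauss_pos less_imp_le intro!: power_mono cmod_fourier_le)
    then show "AE x in lborel \<Otimes>\<^sub>M M. norm (case x of (\<xi>, \<omega>) \<Rightarrow> ?G \<xi> \<omega>)
        \<le> norm (case x of (\<xi>, \<omega>) \<Rightarrow> std_gauss \<xi> * ?L\<^sup>2)"
      by (auto simp: abs_mult std_gauss_pos less_imp_le)
  qed measurable
qed

text \<open>The average of the autocorrelation over a finite distribution of shifts is recovered in the
  limit from the power spectrum and the Fourier transform of that distribution.\<close>

lemma autocorr_average_tendsto:
  fixes V :: "'b \<Rightarrow> 'a"
  assumes cont: "continuous_on UNIV (autocorr f)"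
    and fin: "finite_measure M" and V [measurable]: "V \<in> borel_measurable M"
  shows "(\<lambda>n. (real (Suc n) / sqrt (2 * pi)) ^ DIM('a)
       * (LINT \<xi>|lborel. std_gauss \<xi> * (cmod (fourier f (real (Suc n) *\<^sub>R \<xi>)))\<^sup>2
             * (LINT \<omega>|M. cos (real (Suc n) *\<^sub>R \<xi> \<bullet> V \<omega>))))
     \<longlonglongrightarrow> (LINT \<omega>|M. autocorr f (V \<omega>))"
proof -
  interpret finite_measure M by (rule fin)
  interpret pair_sigma_finite "lborel :: 'a measure" M ..
  let ?L = "LINT x|lborel. \<bar>f x\<bar>"
  have eq: "(s / sqrt (2 * pi)) ^ DIM('a)
       * (LINT \<xi>|lborel. std_gauss \<xi> * (cmod (fourier f (s *\<^sub>R \<xi>)))\<^sup>2 * (LINT \<omega>|M. cos (s *\<^sub>R \<xi> \<bullet> V \<omega>)))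
      = (LINT \<omega>|M. LINT z|lborel. std_gauss z * autocorr f (V \<omega> + (1 / s) *\<^sub>R z))" if "s > 0" for s
    using Fubini_integral[OF integrable_twisted_power_spectrum[OF fin V, of s]] gauss_autocorr[OF that]
    by simp
  have gauss_le: "\<bar>LINT z|lborel. std_gauss z * autocorr f (v + (1 / s) *\<^sub>R z)\<bar> \<le> ?L" if "s > 0" for s v
  proof -
    have "\<bar>LINT z|lborel. std_gauss z * autocorr f (v + (1 / s) *\<^sub>R z)\<bar>
        \<le> (LINT z|lborel. std_gauss (z::'a) * ?L)"
    proof (rule integral_abs_bound_integral)
      show "integrable lborel (\<lambda>z. std_gauss z * autocorr f (v + (1 / s) *\<^sub>R z))"
        by (rule Bochner_Integration.integrable_bound[where f = "\<lambda>z. std_gauss z * ?L"])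
           (auto simp: abs_mult std_gauss_integrable std_gauss_pos less_imp_le autocorr_le)
    qed (auto simp: abs_mult std_gauss_integrable std_gauss_pos less_imp_le autocorr_le intro!: mult_left_mono)
    then show ?thesis by (simp add: std_gauss_integral)
  qed
  have "(\<lambda>n. LINT \<omega>|M. LINT z|lborel. std_gauss z * autocorr f (V \<omega> + (1 / real (Suc n)) *\<^sub>R z))
     \<longlonglongrightarrow> (LINT \<omega>|M. autocorr f (V \<omega>))"
  proof (rule integral_dominated_convergence[where w = "\<lambda>_. ?L"])
    show "AE \<omega> in M. (\<lambda>n. LINT z|lborel. std_gauss z * autocorr f (V \<omega> + (1 / real (Suc n)) *\<^sub>R z))
        \<longlonglongrightarrow> autocorr f (V \<omega>)"
      by (intro AE_I2 gauss_autocorr_tendsto cont)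
    show "AE \<omega> in M. norm (LINT z|lborel. std_gauss z * autocorr f (V \<omega> + (1 / real (Suc n)) *\<^sub>R z)) \<le> ?L" for n
      using gauss_le[of "real (Suc n)"] by simp
  qed auto
  then show "(\<lambda>n. (real (Suc n) / sqrt (2 * pi)) ^ DIM('a)
       * (LINT \<xi>|lborel. std_gauss \<xi> * (cmod (fourier f (real (Suc n) *\<^sub>R \<xi>)))\<^sup>2
             * (LINT \<omega>|M. cos (real (Suc n) *\<^sub>R \<xi> \<bullet> V \<omega>))))
     \<longlonglongrightarrow> (LINT \<omega>|M. autocorr f (V \<omega>))"
    by (subst eq) auto
qed

text \<open>A continuous autocorrelation is a positive definite function, and it therefore pairs
  nonnegatively with every signed measure whose Fourier transform is nonnegative. The signed
  measure is presented as a linear combination of images of one finite measure, which is how the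
  circle measures and the point mass at \<open>0\<close> arise in the application. Before the limit is taken
  the pairing is an integral of nonnegative functions.\<close>

lemma autocorr_average_nonneg:
  fixes V :: "'i \<Rightarrow> 'b \<Rightarrow> 'a" and c :: "'i \<Rightarrow> real"
  assumes cont: "continuous_on UNIV (autocorr f)" and fin: "finite_measure M"
    and V: "\<And>i. i \<in> I \<Longrightarrow> V i \<in> borel_measurable M"
    and pos: "\<And>\<eta>. (\<Sum>i\<in>I. c i * (LINT \<omega>|M. cos (\<eta> \<bullet> V i \<omega>))) \<ge> 0"
  shows "(\<Sum>i\<in>I. c i * (LINT \<omega>|M. autocorr f (V i \<omega>))) \<ge> 0"
proof (rule LIMSEQ_le_const)
  let ?k = "\<lambda>s. (s / sqrt (2 * pi)) ^ DIM('a)"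
  let ?w = "\<lambda>s \<xi>. std_gauss \<xi> * (cmod (fourier f (s *\<^sub>R \<xi>)))\<^sup>2"
  let ?T = "\<lambda>s i. LINT \<xi>|lborel. ?w s \<xi> * (LINT \<omega>|M. cos (s *\<^sub>R \<xi> \<bullet> V i \<omega>))"
  show "(\<lambda>n. \<Sum>i\<in>I. c i * (?k (real (Suc n)) * ?T (real (Suc n)) i))
      \<longlonglongrightarrow> (\<Sum>i\<in>I. c i * (LINT \<omega>|M. autocorr f (V i \<omega>)))"
    by (intro tendsto_sum tendsto_mult tendsto_const autocorr_average_tendsto cont fin V)
  have int: "integrable lborel (\<lambda>\<xi>. ?w s \<xi> * (LINT \<omega>|M. cos (s *\<^sub>R \<xi> \<bullet> V i \<omega>)))"
    if "i \<in> I" for s i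
  proof -
    interpret finite_measure M by (rule fin)
    interpret pair_sigma_finite "lborel :: 'a measure" M ..
    show ?thesis
      using integrable_fst[OF integrable_twisted_power_spectrum[OF fin V[OF that], of s]] by simp
  qed
  have "0 \<le> (\<Sum>i\<in>I. c i * (?k s * ?T s i))" if "s > 0" for s
  proof -
    have "(\<Sum>i\<in>I. c i * (?k s * ?T s i)) = ?k s * (\<Sum>i\<in>I. c i * ?T s i)"
      by (simp add: sum_distrib_left mult_ac)
    also have "(\<Sum>i\<in>I. c i * ?T s i)
        = (LINT \<xi>|lborel. (\<Sum>i\<in>I. c i * (?w s \<xi> * (LINT \<omega>|M. cos (s *\<^sub>R \<xi> \<bullet> V i \<omega>)))))"
      by (subst Bochner_Integration.integral_sum)
         (simp_all only: integral_mult_right_zero integrable_mult_right int)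
    also have "\<dots> = (LINT \<xi>|lborel. ?w s \<xi> * (\<Sum>i\<in>I. c i * (LINT \<omega>|M. cos (s *\<^sub>R \<xi> \<bullet> V i \<omega>))))"
      by (simp add: sum_distrib_left mult_ac)
    also have "?k s * \<dots> \<ge> 0"
      using that
      by (intro mult_nonneg_nonneg Bochner_Integration.integral_nonneg zero_le_power divide_nonneg_nonneg pos)
         (simp_all add: std_gauss_pos less_imp_le)
    finally show ?thesis .
  qed
  then show "\<exists>N. \<forall>n\<ge>N. 0 \<le> (\<Sum>i\<in>I. c i * (?k (real (Suc n)) * ?T (real (Suc n)) i))"
    by simp
qed

end

section \<open>Autocorrelations of bounded sets are continuous\<close>

text \<open>Squeeze \<open>S\<close> between a compact \<open>K\<close> and an open \<open>U\<close> of almost the same measure. A shift shorter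
  than the distance from \<open>K\<close> to the complement of \<open>U\<close> can change membership in \<open>S\<close> only where \<open>x\<close>
  or its translate lies in \<open>U - K\<close>.\<close>

lemma L1_translation_small:
  fixes S :: "'a::euclidean_space set"
  assumes S: "S \<in> sets borel" "bounded S" and "\<epsilon> > 0"
  obtains \<delta> where "\<delta> > 0"
    "\<And>w. norm w < \<delta> \<Longrightarrow> (LINT x|lborel. \<bar>indicat_real S (x + w) - indicat_real S x\<bar>) < \<epsilon>"
proof -
  have S': "S \<in> sets lebesgue" using S by (simp add: sets_completionI_sets)
  obtain K where K: "closed K" "K \<subseteq> S" "S - K \<in> lmeasurable" "emeasure lebesgue (S - K) < ennreal (\<epsilon> / 4)"
    using sets_lebesgue_inner_closed[OF S', of "\<epsilon> / 4"] \<open>\<epsilon> > 0\<close> by auto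
  obtain U where U: "open U" "S \<subseteq> U" "U - S \<in> lmeasurable" "emeasure lebesgue (U - S) < ennreal (\<epsilon> / 4)"
    using sets_lebesgue_outer_open[OF S', of "\<epsilon> / 4"] \<open>\<epsilon> > 0\<close> by auto
  have "compact K"
    using K S bounded_subset by (auto simp: compact_eq_bounded_closed)
  then obtain \<delta> where \<delta>: "\<delta> > 0" "(\<Union>x\<in>K. cball x \<delta>) \<subseteq> U"
    using compact_subset_open_imp_cball_epsilon_subset[of K U] U K by auto
  let ?D = "U - K"
  have [measurable]: "?D \<in> sets borel" "S \<in> sets borel" using U K S by auto
  have "?D = (U - S) \<union> (S - K)" using U K by auto
  then have D_lm: "?D \<in> lmeasurable"
    using fmeasurable.Un[OF U(3) K(3)] by simp
  have "measure lebesgue ?D \<le> measure lebesgue (U - S) + measure lebesgue (S - K)"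
    unfolding \<open>?D = _\<close> using U K by (intro measure_Un_le) (auto simp: fmeasurableD)
  also have "\<dots> < \<epsilon> / 4 + \<epsilon> / 4"
    using U(4)[unfolded emeasure_eq_measure2[OF U(3)]] K(4)[unfolded emeasure_eq_measure2[OF K(3)]]
    by (intro add_strict_mono) (simp_all only: ennreal_less_iff[OF measure_nonneg])
  finally have D: "measure lborel ?D < \<epsilon> / 2" by simp
  have D_int: "integrable lborel (indicat_real ?D)"
    using D_lm by (simp add: fmeasurable_def less_top)
  have S_int: "integrable lborel (indicat_real S)"
    using emeasure_bounded_finite[OF S(2)] by (simp add: less_top)
  show thesis
  proof
    fix w :: 'a assume w: "norm w < \<delta>"
    have near: "x + w \<in> U" "x - w \<in> U" if "x \<in> K" for x
    proof -
      have "x + w \<in> cball x \<delta>" "x - w \<in> cball x \<delta>"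
        using w by (simp_all add: dist_norm)
      then show "x + w \<in> U" "x - w \<in> U"
        using \<delta>(2) that by blast+
    qed
    have "\<bar>indicat_real S (x + w) - indicat_real S x\<bar> \<le> indicat_real ?D x + indicat_real ?D (w + x)" for x
      using near(1)[of x] near(2)[of "x + w"] K(2) U(2) by (auto simp: indicator_def add.commute)
    then have "(LINT x|lborel. \<bar>indicat_real S (x + w) - indicat_real S x\<bar>)
        \<le> (LINT x|lborel. indicat_real ?D x + indicat_real ?D (w + x))"
      using S_int D_int lborel_integrable_shift[OF S_int, of w] lborel_integrable_shift[OF D_int, of w]
      by (intro integral_mono) (auto simp: add.commute)
    also have "\<dots> = 2 * measure lborel ?D"
      using D_int lborel_integrable_shift[OF D_int, of w] lborel_integral_shift[of "indicat_real ?D" w]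
      by simp
    finally show "(LINT x|lborel. \<bar>indicat_real S (x + w) - indicat_real S x\<bar>) < \<epsilon>"
      using D by simp
  qed (rule \<delta>)
qed

lemma integrable_indicator_bounded:
  fixes S :: "'a::euclidean_space set"
  assumes "S \<in> sets borel" "bounded S"
  shows "integrable lborel (indicat_real S)"
  using emeasure_bounded_finite[OF assms(2)] assms(1)
  by (intro integrable_real_indicator) simp_all

definition signed_indicator :: "'a set \<Rightarrow> 'a set \<Rightarrow> 'a \<Rightarrow> real" where
  "signed_indicator S T x = indicat_real S x - indicat_real T x"

lemma abs_signed_indicator_le: "\<bar>signed_indicator S T x\<bar> \<le> 1"
  by (simp add: signed_indicator_def indicator_def)

lemma integrable_signed_indicator:
  fixes S T :: "'a::euclidean_space set"
  assumes "S \<in> sets borel" "bounded S" "T \<in> sets borel" "bounded T"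
  shows "integrable lborel (signed_indicator S T)"
  unfolding signed_indicator_def[abs_def]
  by (intro Bochner_Integration.integrable_diff integrable_indicator_bounded assms)

text \<open>Moving the shift from \<open>v\<close> to \<open>v'\<close> changes the autocorrelation by at most the \<open>L\<^sup>1\<close>-distance
  between the function and its translate by \<open>v' - v\<close>.\<close>

lemma continuous_on_autocorr:
  fixes S T :: "'a::euclidean_space set"
  assumes S: "S \<in> sets borel" "bounded S" and T: "T \<in> sets borel" "bounded T"
  shows "continuous_on UNIV (autocorr (signed_indicator S T))"
proof -
  define f where "f = signed_indicator S T"
  have int: "integrable lborel (indicat_real S)" "integrable lborel (indicat_real T)"
    by (intro integrable_indicator_bounded S T)+
  have int_f: "integrable lborel f"
    unfolding f_def by (intro integrable_signed_indicator S T)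
  have f1: "\<bar>f x\<bar> \<le> 1" for x
    unfolding f_def by (rule abs_signed_indicator_le)
  have shift: "integrable lborel (\<lambda>x. h (x + v))" if "integrable lborel h" for h :: "'a \<Rightarrow> real" and v
    using lborel_integrable_shift[OF that, of v] by (simp add: add.commute)
  note [simp] = shift[OF int(1)] shift[OF int(2)] shift[OF int_f] int int_f
  have main: "\<exists>\<delta>>0. \<forall>v'. dist v' v < \<delta> \<longrightarrow> dist (autocorr f v') (autocorr f v) < \<epsilon>" if "\<epsilon> > 0" for v \<epsilon>
  proof -
    have e2: "\<epsilon> / 2 > 0" using that by simp
    obtain \<delta>1 where \<delta>1: "\<delta>1 > 0" "\<And>w. norm w < \<delta>1 \<Longrightarrow> (LINT x|lborel. \<bar>indicat_real S (x + w) - indicat_real S x\<bar>) < \<epsilon> / 2"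
      by (rule L1_translation_small[OF S e2]) (rule that)
    obtain \<delta>2 where \<delta>2: "\<delta>2 > 0" "\<And>w. norm w < \<delta>2 \<Longrightarrow> (LINT x|lborel. \<bar>indicat_real T (x + w) - indicat_real T x\<bar>) < \<epsilon> / 2"
      by (rule L1_translation_small[OF T e2]) (rule that)
    have "dist (autocorr f v') (autocorr f v) < \<epsilon>" if v': "dist v' v < min \<delta>1 \<delta>2" for v'
    proof -
      let ?w = "v' - v"
      let ?d = "\<lambda>A x. \<bar>indicat_real A (x + ?w) - indicat_real A x\<bar>"
      have [measurable]: "f \<in> borel_measurable borel" "S \<in> sets borel" "T \<in> sets borel"
        using borel_measurable_integrable[OF int_f] S T by simp_all
      have "\<bar>autocorr f v' - autocorr f v\<bar> = \<bar>LINT x|lborel. f x * (f (x + v') - f (x + v))\<bar>"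
        unfolding autocorr_def right_diff_distrib
        by (simp add: integrable_autocorr_integrand[OF int_f f1])
      also have "\<dots> \<le> (LINT x|lborel. \<bar>f (x + v') - f (x + v)\<bar>)"
      proof (rule order_trans[OF integral_abs_bound integral_mono])
        show "\<bar>f x * (f (x + v') - f (x + v))\<bar> \<le> \<bar>f (x + v') - f (x + v)\<bar>" for x
          unfolding abs_mult by (intro mult_left_le_one_le f1) auto
      qed (auto simp: right_diff_distrib integrable_autocorr_integrand[OF int_f f1])
      also have "\<dots> = (LINT x|lborel. \<bar>f (v + x + ?w) - f (v + x)\<bar>)"
        by (simp add: algebra_simps)
      also have "\<dots> = (LINT x|lborel. \<bar>f (x + ?w) - f x\<bar>)"
        by (rule lborel_integral_shift[of "\<lambda>x. \<bar>f (x + ?w) - f x\<bar>"]) measurable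
      also have "\<dots> \<le> (LINT x|lborel. ?d S x + ?d T x)"
        by (intro integral_mono) (auto simp: f_def signed_indicator_def)
      also have "\<dots> = (LINT x|lborel. ?d S x) + (LINT x|lborel. ?d T x)"
        by (intro Bochner_Integration.integral_add) auto
      also have "\<dots> < \<epsilon>"
        using \<delta>1(2)[of ?w] \<delta>2(2)[of ?w] v' by (simp add: dist_norm)
      finally show ?thesis by (simp add: dist_real_def)
    qed
    then show ?thesis using \<delta>1 \<delta>2 by (intro exI[of _ "min \<delta>1 \<delta>2"]) auto
  qed
  then show ?thesis
    by (auto simp: continuous_on_iff f_def)
qed

section \<open>The Bessel function: decay and circle averages\<close>

text \<open>Bessel's equation, in the form \<open>t J'' + J' + t J = 0\<close>. With \<open>q = t\<^sup>2 / 4\<close> the function becomes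
  an entire power series \<open>P0\<close> in \<open>q\<close> satisfying \<open>q P0'' + P0' + P0 = 0\<close>, which is the recursion
  \<open>(n + 1)\<^sup>2 c (n + 1) = - c n\<close> of its coefficients.\<close>

lemma bessel_J0_ode:
  obtains J1 J2 where
    "\<And>t. (bessel_J0 has_real_derivative J1 t) (at t)"
    "\<And>t. (J1 has_real_derivative J2 t) (at t)"
    "\<And>t. t * J2 t + J1 t + t * bessel_J0 t = 0"
proof -
  define c :: "nat \<Rightarrow> real" where "c n = (-1) ^ n / (fact n)\<^sup>2" for n
  define P0 where "P0 q = (\<Sum>n. c n * q ^ n)" for q
  define P1 where "P1 q = (\<Sum>n. diffs c n * q ^ n)" for q
  define P2 where "P2 q = (\<Sum>n. diffs (diffs c) n * q ^ n)" for q
  have sc: "summable (\<lambda>n. c n * y ^ n)" for y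
  proof (rule powser_inside)
    have "\<bar>y\<bar> + 1 = (2 * sqrt (\<bar>y\<bar> + 1) / 2) ^ 2"
      by simp
    then show "summable (\<lambda>n. c n * (\<bar>y\<bar> + 1) ^ n)"
      using summable_bessel_J0[of "2 * sqrt (\<bar>y\<bar> + 1)"]
      by (simp add: c_def power_mult)
  qed simp
  have sd: "summable (\<lambda>n. diffs c n * y ^ n)" for y
    by (rule termdiff_converges_all) (rule sc)
  have sdd: "summable (\<lambda>n. diffs (diffs c) n * y ^ n)" for y
    by (rule termdiff_converges_all) (rule sd)
  have J_eq: "bessel_J0 = (\<lambda>t. P0 (t\<^sup>2 / 4))"
  proof
    fix t :: real
    have "(t / 2) ^ (2 * k) = (t\<^sup>2 / 4) ^ k" for k
      by (simp add: power_mult power_divide)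
    then show "bessel_J0 t = P0 (t\<^sup>2 / 4)"
      by (simp only: bessel_J0_def P0_def c_def times_divide_eq_left)
  qed
  have D0: "(P0 has_real_derivative P1 q) (at q)" for q
    unfolding P0_def[abs_def] P1_def by (rule termdiffs_strong_converges_everywhere) (rule sc)
  have D1: "(P1 has_real_derivative P2 q) (at q)" for q
    unfolding P1_def[abs_def] P2_def by (rule termdiffs_strong_converges_everywhere) (rule sd)
  have ode: "q * P2 q + P1 q + P0 q = 0" for q
  proof -
    have "(\<lambda>n. q * (diffs (diffs c) n * q ^ n)) sums (q * P2 q)"
      unfolding P2_def by (intro sums_mult summable_sums sdd)
    then have "(\<lambda>n. real (Suc n) * diffs c (Suc n) * q ^ Suc n) sums (q * P2 q)"
      by (simp add: diffs_def[of "diffs c"] mult_ac)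
    then have "(\<lambda>n. real n * diffs c n * q ^ n) sums (q * P2 q)"
      by (subst (asm) sums_Suc_iff) simp
    moreover have "(\<lambda>n. diffs c n * q ^ n) sums P1 q" "(\<lambda>n. c n * q ^ n) sums P0 q"
      unfolding P1_def P0_def by (intro summable_sums sd sc)+
    ultimately have "(\<lambda>n. real n * diffs c n * q ^ n + diffs c n * q ^ n + c n * q ^ n)
        sums (q * P2 q + P1 q + P0 q)"
      by (intro sums_add)
    moreover have "real n * diffs c n * q ^ n + diffs c n * q ^ n + c n * q ^ n = 0" for n
    proof -
      have "(real n + 1) * diffs c n = - c n"
        by (simp add: diffs_def c_def power2_eq_square divide_simps del: of_nat_Suc)
      then have "(real n * diffs c n + diffs c n + c n) * q ^ n = 0"
        by (simp add: algebra_simps)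
      then show ?thesis by (simp add: algebra_simps)
    qed
    ultimately show ?thesis
      by (metis (no_types, lifting) sums_0 sums_cong sums_unique2)
  qed
  show thesis
  proof
    show "(bessel_J0 has_real_derivative P1 (t\<^sup>2 / 4) * (t / 2)) (at t)" for t
      unfolding J_eq by (rule DERIV_chain2[OF D0]) (auto intro!: derivative_eq_intros)
    have "((\<lambda>t. P1 (t\<^sup>2 / 4)) has_real_derivative P2 (t\<^sup>2 / 4) * (t / 2)) (at t)" for t
      by (rule DERIV_chain2[OF D1]) (auto intro!: derivative_eq_intros)
    then show "((\<lambda>t. P1 (t\<^sup>2 / 4) * (t / 2)) has_real_derivative
        P2 (t\<^sup>2 / 4) * (t\<^sup>2 / 4) + P1 (t\<^sup>2 / 4) / 2) (at t)" for t
      by (auto intro!: derivative_eq_intros simp: power2_eq_square)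
    show "t * (P2 (t\<^sup>2 / 4) * (t\<^sup>2 / 4) + P1 (t\<^sup>2 / 4) / 2) + P1 (t\<^sup>2 / 4) * (t / 2) + t * bessel_J0 t = 0" for t
    proof -
      have "t * (t\<^sup>2 / 4 * P2 (t\<^sup>2 / 4) + P1 (t\<^sup>2 / 4) + P0 (t\<^sup>2 / 4)) = 0"
        by (simp only: ode mult_zero_right)
      then show ?thesis unfolding J_eq by (simp add: algebra_simps)
    qed
  qed
qed

lemma continuous_on_bessel_J0: "continuous_on S bessel_J0"
proof -
  obtain J1 where "\<And>t. (bessel_J0 has_real_derivative J1 t) (at t)"
    by (rule bessel_J0_ode) (rule that)
  then show ?thesis
    by (meson DERIV_isCont continuous_at_imp_continuous_on)
qed

text \<open>The function \<open>u = sqrt t * J0 t\<close> satisfies \<open>u'' + (1 + 1 / (4 t\<^sup>2)) u = 0\<close>, so that its energy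
  \<open>E = u'\<^sup>2 + (1 + 1 / (4 t\<^sup>2)) u\<^sup>2\<close> decreases. Hence \<open>u\<close> is bounded, and \<open>J0\<close> decays at least as
  fast as \<open>1 / sqrt t\<close>.\<close>

lemma bessel_J0_tendsto_0: "(bessel_J0 \<longlongrightarrow> 0) at_top"
proof -
  obtain J1 J2 where
    D0: "\<And>t. (bessel_J0 has_real_derivative J1 t) (at t)"
    and D1: "\<And>t. (J1 has_real_derivative J2 t) (at t)"
    and ode: "\<And>t. t * J2 t + J1 t + t * bessel_J0 t = 0"
    by (rule bessel_J0_ode) (rule that)
  (* The energy of u, written in terms of J0 and its derivative. *)
  define E where "E t = t * ((bessel_J0 t)\<^sup>2 + (J1 t)\<^sup>2) + bessel_J0 t * J1 t
      + (bessel_J0 t)\<^sup>2 / (2 * t)" for t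
  have DE: "(E has_real_derivative - ((bessel_J0 t)\<^sup>2 / (2 * t\<^sup>2))) (at t)" if t: "t > 0" for t
  proof -
    define r where "r = J1 t / t"
    have J1: "J1 t = r * t" and J2: "J2 t = - r - bessel_J0 t"
      using ode[of t] t by (simp_all add: r_def field_simps)
    have D: "(E has_real_derivative (1 * (bessel_J0 t * bessel_J0 t + J1 t * J1 t)
        + (J1 t * bessel_J0 t + J1 t * bessel_J0 t + (J2 t * J1 t + J2 t * J1 t)) * t)
        + (J1 t * J1 t + J2 t * bessel_J0 t)
        + ((J1 t * bessel_J0 t + J1 t * bessel_J0 t) * (2 * t) - bessel_J0 t * bessel_J0 t * (2 * 1))
            / ((2 * t) * (2 * t))) (at t)"
      unfolding E_def[abs_def] power2_eq_square
      by (rule DERIV_add[OF DERIV_add[OF DERIV_mult[OF DERIV_ident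
              DERIV_add[OF DERIV_mult[OF D0 D0] DERIV_mult[OF D1 D1]]] DERIV_mult'[OF D0 D1, THEN DERIV_cong]]
            DERIV_divide[OF DERIV_mult[OF D0 D0] DERIV_cmult[OF DERIV_ident]]])
         (use t in simp_all)
    have frac: "((r * t * a + r * t * a) * (2 * t) - a * a * (2 * 1)) / ((2 * t) * (2 * t))
        = a * r - a\<^sup>2 / (2 * t\<^sup>2)" for a
      using t by (simp add: diff_divide_distrib power2_eq_square)
    show ?thesis
      by (rule DERIV_cong[OF D[unfolded J1 J2]], unfold frac) (simp add: algebra_simps power2_eq_square)
  qed
  have E_mono: "E t \<le> E 1" if "t \<ge> 1" for t
  proof (rule DERIV_nonpos_imp_nonincreasing[OF that])
    fix x :: real assume "1 \<le> x"
    then show "\<exists>y. (E has_real_derivative y) (at x) \<and> y \<le> 0"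
      using DE[of x] by (intro exI[of _ "- ((bessel_J0 x)\<^sup>2 / (2 * x\<^sup>2))"] conjI) simp_all
  qed
  have E_ge: "t * (bessel_J0 t)\<^sup>2 \<le> E t" if "t > 0" for t
  proof -
    have "E t = t * (bessel_J0 t)\<^sup>2 + (2 * t * J1 t + bessel_J0 t)\<^sup>2 / (4 * t) + (bessel_J0 t)\<^sup>2 / (4 * t)"
    proof -
      have sq: "(2 * t * b + a)\<^sup>2 / (4 * t) = t * b\<^sup>2 + a * b + a\<^sup>2 / (4 * t)" for a b
      proof -
        have "(2 * t * b + a)\<^sup>2 = 4 * t * (t * b\<^sup>2 + a * b) + a\<^sup>2"
          by (simp add: power2_eq_square algebra_simps)
        then show ?thesis
          using that by (simp add: add_divide_distrib)
      qed
      have half: "a / (2 * t) = a / (4 * t) + a / (4 * t)" for a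
        by simp
      show ?thesis
        unfolding E_def sq half by (simp add: algebra_simps)
    qed
    then show ?thesis using that by simp
  qed
  have bd: "\<bar>bessel_J0 t\<bar> \<le> sqrt (E 1 / t)" if "t \<ge> 1" for t
  proof (rule real_le_rsqrt)
    show "\<bar>bessel_J0 t\<bar>\<^sup>2 \<le> E 1 / t"
      using E_ge[of t] E_mono[of t] that by (simp add: pos_le_divide_eq mult.commute)
  qed
  show ?thesis
  proof (rule Lim_null_comparison)
    show "\<forall>\<^sub>F t in at_top. norm (bessel_J0 t) \<le> sqrt (E 1 / t)"
      using eventually_ge_at_top[of 1] by eventually_elim (use bd in simp)
    have "((\<lambda>t. E 1 / t) \<longlongrightarrow> 0) at_top"
      by (rule tendsto_divide_0[OF tendsto_const filterlim_at_top_imp_at_infinity[OF filterlim_ident]])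
    then show "((\<lambda>t. sqrt (E 1 / t)) \<longlongrightarrow> 0) at_top"
      using tendsto_real_sqrt by fastforce
  qed
qed

text \<open>A strict pointwise bound does not suffice for the limiting argument. Compactness upgrades it
  to a uniform one, because the function tends to \<open>0 > -1\<close> at infinity.\<close>

lemma uniform_gap_above_minus_1:
  fixes F :: "real \<Rightarrow> real"
  assumes cont: "continuous_on {0..} F" and lim: "(F \<longlongrightarrow> 0) at_top"
    and gt: "\<And>t. t \<ge> 0 \<Longrightarrow> F t > -1"
  obtains \<epsilon> where "\<epsilon> > 0" "\<epsilon> \<le> 1" "\<And>t. t \<ge> 0 \<Longrightarrow> F t \<ge> -1 + \<epsilon>"
proof -
  have "\<forall>\<^sub>F t in at_top. F t > -1/2"
    using lim by (rule order_tendstoD) simp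
  then obtain T0 where T0: "\<And>t. t \<ge> T0 \<Longrightarrow> F t > -1/2"
    by (auto simp: eventually_at_top_linorder)
  define T where "T = max 0 T0"
  obtain m where m: "m \<in> {0..T}" "\<And>t. t \<in> {0..T} \<Longrightarrow> F m \<le> F t"
    using continuous_attains_inf[of "{0..T}" F] cont
    by (force simp: T_def intro: continuous_on_subset)
  show thesis
  proof
    show "min (1/2) (F m + 1) > 0"
      using gt[of m] m by simp
    show "F t \<ge> -1 + min (1/2) (F m + 1)" if "t \<ge> 0" for t
    proof (cases "t \<le> T")
      case True
      then show ?thesis using m(2)[of t] that by simp
    next
      case False
      then have "F t > -1/2" by (intro T0) (simp add: T_def)
      then show ?thesis by simp
    qed
  qed simp
qed

text \<open>Left unnormalised, with total mass \<open>2 * pi\<close>.\<close>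

definition angle_measure :: "real measure" where
  "angle_measure = restrict_space lborel {0..2 * pi}"

lemma finite_measure_angle: "finite_measure angle_measure"
  by (rule finite_measureI) (simp add: angle_measure_def emeasure_restrict_space)

lemma measure_angle: "measure angle_measure (space angle_measure) = 2 * pi"
  by (simp add: angle_measure_def measure_restrict_space)

lemma measurable_angle [measurable]: "F \<in> borel_measurable borel \<Longrightarrow> F \<in> measurable angle_measure borel"
  unfolding angle_measure_def by (rule measurable_restrict_space1) simp

lemma angle_FTC:
  fixes F F' :: "real \<Rightarrow> real"
  assumes "\<And>x. (F has_real_derivative F' x) (at x)" "continuous_on UNIV F'"
  shows "(LINT \<theta>|angle_measure. F' \<theta>) = F (2 * pi) - F 0"
  unfolding angle_measure_def
  using integral_FTC_Icc_real[of 0 "2 * pi" F F'] assms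
  by (subst integral_restrict_space) (auto simp: continuous_on_eq_continuous_at mult.commute)

text \<open>Let \<open>g\<close> be the base of the power and \<open>h\<close> its derivative, so that \<open>g\<^sup>2 + h\<^sup>2 = p\<^sup>2 + q\<^sup>2\<close> and
  \<open>h' = - g\<close>. Integrating the derivative of the periodic function \<open>h g\<^bsup>2 k + 1\<^esup>\<close> over a period yields
  Wallis' recursion directly for general \<open>p\<close> and \<open>q\<close>; the rotation invariance of the answer comes
  out of the induction.\<close>

lemma angle_moment:
  "(LINT \<theta>|angle_measure. (p * cos \<theta> + q * sin \<theta>) ^ (2 * k))
    = 2 * pi * fact (2 * k) / (4 ^ k * (fact k)\<^sup>2) * (p\<^sup>2 + q\<^sup>2) ^ k"
proof (induction k)
  case 0
  show ?case using measure_angle by simp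
next
  case (Suc k)
  interpret finite_measure angle_measure by (rule finite_measure_angle)
  let ?g = "\<lambda>\<theta>. p * cos \<theta> + q * sin \<theta>" and ?h = "\<lambda>\<theta>. q * cos \<theta> - p * sin \<theta>"
  let ?A = "\<lambda>k. LINT \<theta>|angle_measure. ?g \<theta> ^ (2 * k)"
  have int: "integrable angle_measure (\<lambda>\<theta>. ?g \<theta> ^ m)" for m
  proof (rule integrable_const_bound[where B = "(\<bar>p\<bar> + \<bar>q\<bar>) ^ m"])
    have "\<bar>?g \<theta>\<bar> \<le> \<bar>p\<bar> + \<bar>q\<bar>" for \<theta>
      by (rule order_trans[OF abs_triangle_ineq])
         (auto simp: abs_mult intro!: add_mono mult_left_le)
    then show "AE \<theta> in angle_measure. norm (?g \<theta> ^ m) \<le> (\<bar>p\<bar> + \<bar>q\<bar>) ^ m"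
      by (auto simp: power_abs intro!: power_mono)
  qed measurable
  have sq: "(?h \<theta>)\<^sup>2 = p\<^sup>2 + q\<^sup>2 - (?g \<theta>)\<^sup>2" for \<theta>
  proof -
    have "(?h \<theta>)\<^sup>2 + (?g \<theta>)\<^sup>2 = (p\<^sup>2 + q\<^sup>2) * ((sin \<theta>)\<^sup>2 + (cos \<theta>)\<^sup>2)"
      by (simp only: power2_eq_square) algebra
    then show ?thesis by simp
  qed
  have "(LINT \<theta>|angle_measure. (2 * real k + 1) * (p\<^sup>2 + q\<^sup>2) * ?g \<theta> ^ (2 * k)
      - (2 * real k + 2) * ?g \<theta> ^ (2 * Suc k)) = ?h (2 * pi) * ?g (2 * pi) ^ (2 * k + 1) - ?h 0 * ?g 0 ^ (2 * k + 1)"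
  proof (rule angle_FTC)
    fix \<theta>
    have "((\<lambda>\<theta>. ?h \<theta> * ?g \<theta> ^ (2 * k + 1)) has_real_derivative
       ?h \<theta> * ((2 * real k + 1) * ?g \<theta> ^ (2 * k) * ?h \<theta>) - ?g \<theta> * ?g \<theta> ^ (2 * k + 1)) (at \<theta>)"
      by (rule derivative_eq_intros refl)+ (simp add: algebra_simps)
    also have "?h \<theta> * ((2 * real k + 1) * ?g \<theta> ^ (2 * k) * ?h \<theta>) - ?g \<theta> * ?g \<theta> ^ (2 * k + 1)
       = (2 * real k + 1) * (?h \<theta>)\<^sup>2 * ?g \<theta> ^ (2 * k) - (?g \<theta>)\<^sup>2 * ?g \<theta> ^ (2 * k)"
      by (simp add: power2_eq_square)
    also have "\<dots> = (2 * real k + 1) * (p\<^sup>2 + q\<^sup>2) * ?g \<theta> ^ (2 * k)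
      - (2 * real k + 2) * ?g \<theta> ^ (2 * Suc k)"
      unfolding sq by (simp add: power2_eq_square algebra_simps)
    finally show "((\<lambda>\<theta>. ?h \<theta> * ?g \<theta> ^ (2 * k + 1)) has_real_derivative
       (2 * real k + 1) * (p\<^sup>2 + q\<^sup>2) * ?g \<theta> ^ (2 * k)
      - (2 * real k + 2) * ?g \<theta> ^ (2 * Suc k)) (at \<theta>)" .
  qed (intro continuous_intros)
  also have "\<dots> = 0" by simp
  finally have "(2 * real k + 2) * ?A (Suc k) = (2 * real k + 1) * (p\<^sup>2 + q\<^sup>2) * ?A k"
    by (simp only: Bochner_Integration.integral_diff integrable_mult_right int integral_mult_right_zero)
  then have "?A (Suc k) = (2 * real k + 1) / (2 * real k + 2) * (p\<^sup>2 + q\<^sup>2) * ?A k"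
    by (simp add: field_simps)
  also have "\<dots> = 2 * pi * ((2 * real k + 1) / (2 * real k + 2) * (fact (2 * k) / (4 ^ k * (fact k)\<^sup>2))) * (p\<^sup>2 + q\<^sup>2) ^ Suc k"
    unfolding Suc.IH by simp
  also have "(2 * real k + 1) / (2 * real k + 2) * (fact (2 * k) / (4 ^ k * (fact k)\<^sup>2))
      = fact (2 * Suc k) / (4 ^ Suc k * (fact (Suc k))\<^sup>2)"
  proof -
    have f1: "fact (2 * Suc k) = (2 * real k + 2) * (2 * real k + 1) * fact (2 * k)"
      by (simp add: algebra_simps)
    have f2: "4 ^ Suc k * (fact (Suc k))\<^sup>2 = (2 * real k + 2) * (2 * real k + 2) * (4 ^ k * (fact k)\<^sup>2)"
      by (simp add: algebra_simps power2_eq_square)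
    show ?thesis unfolding f1 f2 by simp
  qed
  finally show ?case by simp
qed

text \<open>Expanding the cosine in its power series and integrating term by term turns the moments into
  the power series of the Bessel function.\<close>

lemma angle_average_cos:
  "(LINT \<theta>|angle_measure. cos (p * cos \<theta> + q * sin \<theta>)) = 2 * pi * bessel_J0 (sqrt (p\<^sup>2 + q\<^sup>2))"
proof -
  interpret finite_measure angle_measure by (rule finite_measure_angle)
  let ?g = "\<lambda>\<theta>. p * cos \<theta> + q * sin \<theta>"
  let ?f = "\<lambda>k \<theta>. (-1) ^ k / fact (2 * k) * ?g \<theta> ^ (2 * k)"
  define K where "K = \<bar>p\<bar> + \<bar>q\<bar>"
  have gK: "\<bar>?g \<theta>\<bar> \<le> K" for \<theta>
    unfolding K_def
    by (rule order_trans[OF abs_triangle_ineq]) (auto simp: abs_mult intro!: add_mono mult_left_le)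
  have bd: "norm (?f k \<theta>) \<le> K ^ (2 * k) / fact (2 * k)" for k \<theta>
    using power_mono[OF gK[of \<theta>] abs_ge_zero, of "2 * k"]
    by (simp add: abs_mult power_abs divide_right_mono)
  have sumK: "summable (\<lambda>k. K ^ (2 * k) / fact (2 * k))"
  proof (rule summable_comparison_test'[where N = 0])
    show "summable (\<lambda>k. inverse (fact k) * (K\<^sup>2) ^ k)"
      by (rule summable_exp)
    show "norm (K ^ (2 * k) / fact (2 * k)) \<le> inverse (fact k) * (K\<^sup>2) ^ k" for k
    proof -
      have "(fact k :: real) \<le> fact (2 * k)"
        by (rule fact_mono) simp
      then show ?thesis
        by (simp add: power_mult abs_mult power_abs divide_simps mult_left_mono)
    qed
  qed
  have int: "integrable angle_measure (?f k)" for k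
    by (rule integrable_const_bound[where B = "K ^ (2 * k) / fact (2 * k)"]) (use bd in auto)
  have "(\<lambda>k. LINT \<theta>|angle_measure. ?f k \<theta>) sums (LINT \<theta>|angle_measure. (\<Sum>k. ?f k \<theta>))"
  proof (rule sums_integral)
    show "AE \<theta> in angle_measure. summable (\<lambda>k. norm (?f k \<theta>))"
      by (intro AE_I2 summable_comparison_test'[OF sumK, where N = 0]) (use bd in simp)
    show "summable (\<lambda>k. LINT \<theta>|angle_measure. norm (?f k \<theta>))"
    proof (rule summable_comparison_test'[where N = 0])
      show "summable (\<lambda>k. 2 * pi * (K ^ (2 * k) / fact (2 * k)))"
        by (intro summable_mult sumK)
      show "norm (LINT \<theta>|angle_measure. norm (?f k \<theta>)) \<le> 2 * pi * (K ^ (2 * k) / fact (2 * k))" for k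
      proof -
        have "(LINT \<theta>|angle_measure. norm (?f k \<theta>)) \<le> (LINT \<theta>|angle_measure. K ^ (2 * k) / fact (2 * k))"
          by (intro integral_mono integrable_norm int bd integrable_const)
        then show ?thesis
          using measure_angle by simp
      qed
    qed
  qed (rule int)
  moreover have "(\<Sum>k. ?f k \<theta>) = cos (?g \<theta>)" for \<theta>
    using cos_paired[of "?g \<theta>"] by (simp add: sums_iff)
  moreover have "(LINT \<theta>|angle_measure. ?f k \<theta>)
      = 2 * pi * ((-1) ^ k * (sqrt (p\<^sup>2 + q\<^sup>2) / 2) ^ (2 * k) / (fact k)\<^sup>2)" for k
    by (simp only: integral_mult_right_zero angle_moment)
       (simp add: power_mult power_divide)
  ultimately have "(\<lambda>k. 2 * pi * ((-1) ^ k * (sqrt (p\<^sup>2 + q\<^sup>2) / 2) ^ (2 * k) / (fact k)\<^sup>2))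
      sums (LINT \<theta>|angle_measure. cos (?g \<theta>))"
    by simp
  moreover have "(\<lambda>k. 2 * pi * ((-1) ^ k * (sqrt (p\<^sup>2 + q\<^sup>2) / 2) ^ (2 * k) / (fact k)\<^sup>2))
      sums (2 * pi * bessel_J0 (sqrt (p\<^sup>2 + q\<^sup>2)))"
    unfolding bessel_J0_def by (intro sums_mult summable_sums summable_bessel_J0)
  ultimately show ?thesis
    by (rule sums_unique2)
qed

definition unit_dir :: "real \<Rightarrow> real ^ 2" where
  "unit_dir \<theta> = cos \<theta> *\<^sub>R axis 1 1 + sin \<theta> *\<^sub>R axis 2 1"

lemma unit_dir_nth [simp]: "unit_dir \<theta> $ 1 = cos \<theta>" "unit_dir \<theta> $ 2 = sin \<theta>"
  by (simp_all add: unit_dir_def axis_def)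

lemma norm_unit_dir: "norm (unit_dir \<theta>) = 1"
  by (simp add: norm_vec_def L2_set_def sum_2)

lemma unit_dir_measurable [measurable]: "unit_dir \<in> borel_measurable borel"
  unfolding unit_dir_def[abs_def] by measurable

text \<open>The Fourier transform of the uniform measure on the circle of radius \<open>r\<close>, up to the total mass
  \<open>2 * pi\<close>, is \<open>J0 (r * norm \<eta>)\<close>.\<close>

lemma circle_average_cos:
  assumes "r \<ge> 0"
  shows "(LINT \<theta>|angle_measure. cos (\<eta> \<bullet> (r *\<^sub>R unit_dir \<theta>))) = 2 * pi * bessel_J0 (r * norm \<eta>)"
proof -
  have "\<eta> \<bullet> (r *\<^sub>R unit_dir \<theta>) = (r * \<eta> $ 1) * cos \<theta> + (r * \<eta> $ 2) * sin \<theta>" for \<theta>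
    by (simp add: inner_vec_def sum_2 mult_ac)
  moreover have "sqrt ((r * \<eta> $ 1)\<^sup>2 + (r * \<eta> $ 2)\<^sup>2) = r * norm \<eta>"
  proof -
    have "(r * \<eta> $ 1)\<^sup>2 + (r * \<eta> $ 2)\<^sup>2 = r\<^sup>2 * ((\<eta> $ 1)\<^sup>2 + (\<eta> $ 2)\<^sup>2)"
      by (simp add: power_mult_distrib distrib_left)
    moreover have "norm \<eta> = sqrt ((\<eta> $ 1)\<^sup>2 + (\<eta> $ 2)\<^sup>2)"
      by (simp add: norm_vec_def L2_set_def sum_2)
    ultimately show ?thesis
      using assms by (simp only: real_sqrt_mult real_sqrt_abs abs_of_nonneg)
  qed
  ultimately show ?thesis
    using angle_average_cos[of "r * \<eta> $ 1" "r * \<eta> $ 2"] by simp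
qed

lemma bessel_J0_0: "bessel_J0 0 = 1"
proof -
  have "(\<lambda>k. (-1) ^ k * (0 / 2) ^ (2 * k) / (fact k :: real)\<^sup>2) sums 1"
    using sums_single[of 0 "\<lambda>_. 1::real"]
    by (rule sums_cong[THEN iffD1, rotated]) (auto simp: power_0_left)
  then show ?thesis unfolding bessel_J0_def by (simp add: sums_iff)
qed

section \<open>Triples in a large cube\<close>

definition cube :: "real \<Rightarrow> (real ^ 'n) set" where
  "cube R = cbox (\<chi> i. - R) (\<chi> i. R)"

lemma mem_cube: "x \<in> cube R \<longleftrightarrow> (\<forall>i. \<bar>x $ i\<bar> \<le> R)"
  by (auto simp: cube_def mem_box_cart abs_le_iff minus_le_iff)

lemma cube_borel [measurable]: "cube R \<in> sets borel"
  by (simp add: cube_def)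

lemma bounded_cube: "bounded (cube R)"
  by (simp add: cube_def)

lemma measure_cube:
  assumes "R \<ge> 0"
  shows "measure lborel (cube R :: (real ^ 'n) set) = (2 * R) ^ CARD('n)"
  using assms content_cbox_cart[of "(\<chi> i. - R) :: real ^ 'n" "\<chi> i. R"]
  by (simp add: cube_def interval_eq_empty_cart)

lemma integrable_cube: "integrable lborel (indicat_real (cube R))"
  by (intro integrable_indicator_bounded cube_borel bounded_cube)

lemma add_mem_cube:
  assumes "x \<in> cube R" "norm v \<le> D"
  shows "x + v \<in> cube (R + D)"
proof -
  have "\<bar>x $ i + v $ i\<bar> \<le> R + D" for i
  proof (rule order_trans[OF abs_triangle_ineq add_mono])
    show "\<bar>x $ i\<bar> \<le> R" using assms(1) by (simp add: mem_cube)
    show "\<bar>v $ i\<bar> \<le> D" using component_le_norm_cart[of v i] assms(2) by simp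
  qed
  then show ?thesis by (simp add: mem_cube)
qed

text \<open>For signs that are not all equal the sum of the pairwise products is \<open>-1\<close>. The value \<open>0\<close> stands
  for a point outside the cube.\<close>

lemma pair_sum_of_signs:
  fixes p q r :: real
  assumes "p \<in> {-1, 0, 1}" "q \<in> {-1, 0, 1}" "r \<in> {-1, 0, 1}"
    and "\<not> (p = 1 \<and> q = 1 \<and> r = 1)" "\<not> (p = -1 \<and> q = -1 \<and> r = -1)"
  shows "p * q + q * r + p * r \<le> 1"
    and "p \<noteq> 0 \<Longrightarrow> q \<noteq> 0 \<Longrightarrow> r \<noteq> 0 \<Longrightarrow> p * q + q * r + p * r = -1"
proof -
  have "p * q + q * r + p * r \<le> 1
      \<and> (p \<noteq> 0 \<longrightarrow> q \<noteq> 0 \<longrightarrow> r \<noteq> 0 \<longrightarrow> p * q + q * r + p * r = -1)"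
    using assms(1,2,3,4,5) by (elim insertE emptyE) simp_all
  then show "p * q + q * r + p * r \<le> 1"
    and "p \<noteq> 0 \<Longrightarrow> q \<noteq> 0 \<Longrightarrow> r \<noteq> 0 \<Longrightarrow> p * q + q * r + p * r = -1"
    by blast+
qed

text \<open>If no translate of \<open>{0, p, q}\<close> lies in one colour, then the three autocorrelations for its
  differences \<open>p\<close>, \<open>q - p\<close> and \<open>q\<close> add up to about minus the volume of the cube: translates
  inside the cube contribute exactly \<open>-1\<close>, and those that only meet it contribute at most \<open>1\<close>. The
  null set \<open>N\<close> makes room for colour classes that are Borel only up to null sets.\<close>

lemma autocorr_triple_le:
  fixes S T N :: "(real ^ 'n) set" and R :: real
  assumes S: "S \<in> sets borel" and T: "T \<in> sets borel" and disj: "S \<inter> T = {}"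
    and N: "N \<in> null_sets lborel" "- (S \<union> T) \<subseteq> N"
    and no_S: "\<And>x. \<not> {x, x + p, x + q} \<subseteq> S" and no_T: "\<And>x. \<not> {x, x + p, x + q} \<subseteq> T"
    and D: "norm p \<le> D" "norm q \<le> D"
  defines "f \<equiv> signed_indicator (S \<inter> cube R) (T \<inter> cube R)"
  shows "autocorr f p + autocorr f (q - p) + autocorr f q
    \<le> measure lborel (cube (R + D) :: (real ^ 'n) set) - 2 * measure lborel (cube (R - D) :: (real ^ 'n) set)"
proof -
  have D0: "D \<ge> 0" using D(1) norm_ge_zero order_trans by blast
  have f_eq: "f x = indicat_real (S \<inter> cube R) x - indicat_real (T \<inter> cube R) x" for x
    by (simp add: f_def signed_indicator_def)
  have f1: "\<bar>f x\<bar> \<le> 1" for x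
    unfolding f_def by (rule abs_signed_indicator_le)
  have int_f: "integrable lborel f"
    unfolding f_def using S T bounded_subset[OF bounded_cube Int_lower2]
    by (intro integrable_signed_indicator sets.Int cube_borel) auto
  note int = integrable_autocorr_integrand[OF int_f f1]
  have shift_eq: "autocorr f (q - p) = (LINT x|lborel. f (x + p) * f (x + q))"
  proof -
    have "(\<lambda>x. f x * f (x + (q - p))) \<in> borel_measurable borel"
      using borel_measurable_integrable[OF int[of "q - p"]]
      by (simp only: measurable_cong_sets[OF sets_lborel refl])
    from lborel_integral_shift[OF this, of p] show ?thesis
      by (simp add: autocorr_def add.commute)
  qed
  have int2: "integrable lborel (\<lambda>x. f (x + p) * f (x + q))"
    using lborel_integrable_shift[OF int[of "q - p"], of p] by (simp add: add.commute)
  have AE_N: "AE x in lborel. x + v \<notin> N" for v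
  proof -
    have N': "N \<in> sets borel" using N(1) by auto
    have "AE x in distr lborel borel ((+) v). x \<notin> N"
      unfolding lborel_distr_plus by (rule AE_not_in[OF N(1)])
    then show ?thesis
      by (subst (asm) AE_distr_iff) (use N' in \<open>auto simp: add.commute\<close>)
  qed
  have "autocorr f p + autocorr f (q - p) + autocorr f q
      = (LINT x|lborel. f x * f (x + p) + f (x + p) * f (x + q) + f x * f (x + q))"
    unfolding shift_eq unfolding autocorr_def by (simp add: int int2)
  also have "\<dots> \<le> (LINT x|lborel. indicat_real (cube (R + D)) (x :: real ^ 'n) - 2 * indicat_real (cube (R - D)) x)"
  proof (rule integral_mono_AE)
    show "AE x in lborel. f x * f (x + p) + f (x + p) * f (x + q) + f x * f (x + q)
        \<le> indicat_real (cube (R + D)) x - 2 * indicat_real (cube (R - D)) x"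
      using AE_N[of 0] AE_N[of p] AE_N[of q]
    proof eventually_elim
      case (elim x)
      have f_set: "f y \<in> {-1, 0, 1}" for y by (auto simp: f_eq indicator_def)
      have f_S: "y \<in> S" if "f y = 1" for y using that by (auto simp: f_eq indicator_def of_bool_def split: if_splits)
      have f_T: "y \<in> T" if "f y = -1" for y using that by (auto simp: f_eq indicator_def of_bool_def split: if_splits)
      have f_0: "f y \<noteq> 0" if "y \<notin> N" "y \<in> cube R" for y
        using that N(2) disj by (auto simp: f_eq indicator_def)
      have f_out: "f y = 0" if "y \<notin> cube R" for y using that by (simp add: f_eq)
      have nS: "\<not> (f x = 1 \<and> f (x + p) = 1 \<and> f (x + q) = 1)"
        using no_S[of x] f_S by blast
      have nT: "\<not> (f x = -1 \<and> f (x + p) = -1 \<and> f (x + q) = -1)"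
        using no_T[of x] f_T by blast
      note sums = pair_sum_of_signs[OF f_set f_set f_set nS nT]
      show ?case
      proof (cases "x \<in> cube (R - D)")
        case True
        then have "x \<in> cube R" "x + p \<in> cube R" "x + q \<in> cube R" "x \<in> cube (R + D)"
          using add_mem_cube[of x "R - D" 0 D] add_mem_cube[of x "R - D" _ D] D D0
          by (auto simp: mem_cube intro: order_trans)
        then show ?thesis
          using sums(2) f_0 elim True by simp
      next
        case x: False
        show ?thesis
        proof (cases "x \<in> cube (R + D)")
          case True
          then show ?thesis using sums(1) x by simp
        next
          case False
          then have "x \<notin> cube R" using add_mem_cube[of x R 0 D] D0 by auto
          moreover have "x + p \<notin> cube R"
            using False add_mem_cube[of "x + p" R "- p" D] D by auto
          ultimately show ?thesis using x False by (simp add: f_out)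
        qed
      qed
    qed
  qed (auto intro!: int int2 integrable_cube Bochner_Integration.integrable_add
        Bochner_Integration.integrable_diff integrable_mult_right)
  also have "\<dots> = measure lborel (cube (R + D) :: (real ^ 'n) set) - 2 * measure lborel (cube (R - D) :: (real ^ 'n) set)"
    by (simp add: integrable_cube)
  finally show ?thesis .
qed

section \<open>Monochromatic triples\<close>

theorem theorem6:
  fixes a \<kappa> :: real
    and A B :: "(real ^ 2) set"
  assumes "a > 0" and "\<kappa> > 0"
    and "\<And>t. t \<ge> 0 \<Longrightarrow> bessel_J0 t + bessel_J0 (\<kappa> * t) + bessel_J0 ((1 + \<kappa>) * t) > -1"
    and "measurable_two_coloring A B"
  shows "\<exists>x y z. monochromatic A B {x, y, z} \<and> collinear {x, y, z} \<and> y \<in> closed_segment x z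
           \<and> norm (y - x) = a \<and> norm (z - y) = \<kappa> * a"
proof (rule ccontr)
  note a = \<open>a > 0\<close> and \<kappa> = \<open>\<kappa> > 0\<close>
  assume contra: "\<not> ?thesis"
  let ?J = "\<lambda>t. bessel_J0 t + bessel_J0 (\<kappa> * t) + bessel_J0 ((1 + \<kappa>) * t)"
  have lim: "((\<lambda>t. bessel_J0 (c * t)) \<longlongrightarrow> 0) at_top" if "c > 0" for c
    by (rule filterlim_compose[OF bessel_J0_tendsto_0])
       (rule filterlim_tendsto_pos_mult_at_top[OF tendsto_const that filterlim_ident])
  have "(?J \<longlongrightarrow> 0 + 0 + 0) at_top"
    using lim[of \<kappa>] lim[of "1 + \<kappa>"] \<kappa> by (intro tendsto_add bessel_J0_tendsto_0) auto
  moreover have "continuous_on {0..} ?J"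
    by (intro continuous_intros continuous_on_compose2[OF continuous_on_bessel_J0[of UNIV]]) auto
  ultimately obtain \<epsilon> where \<epsilon>: "\<epsilon> > 0" "\<epsilon> \<le> 1" and gap: "\<And>t. t \<ge> 0 \<Longrightarrow> ?J t \<ge> -1 + \<epsilon>"
    using uniform_gap_above_minus_1[of ?J] assms(3) by auto

  have col: "A \<in> sets lebesgue" "B \<in> sets lebesgue" "A \<union> B = UNIV" "A \<inter> B = {}"
    using assms(4) by (auto simp: measurable_two_coloring_def)
  (* Autocorrelations require Borel sets, so each colour is replaced by a Borel subset of full
     measure. *)
  obtain S NA NA' where S: "A = S \<union> NA" "NA \<subseteq> NA'" "NA' \<in> null_sets lborel" "S \<in> sets lborel"
    using col(1) by (rule sets_completionE)
  obtain T NB NB' where T: "B = T \<union> NB" "NB \<subseteq> NB'" "NB' \<in> null_sets lborel" "T \<in> sets lborel"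
    using col(2) by (rule sets_completionE)
  have no: "\<not> monochromatic A B {x, x + a *\<^sub>R unit_dir \<theta>, x + ((1 + \<kappa>) * a) *\<^sub>R unit_dir \<theta>}" for x \<theta>
  proof
    let ?y = "x + a *\<^sub>R unit_dir \<theta>" and ?z = "x + ((1 + \<kappa>) * a) *\<^sub>R unit_dir \<theta>"
    assume "monochromatic A B {x, ?y, ?z}"
    moreover have "?y \<in> closed_segment x ?z"
    proof -
      have "(1 - t) *\<^sub>R x + t *\<^sub>R (x + v) = x + t *\<^sub>R v" for t and v :: "real ^ 2"
        by (simp add: algebra_simps)
      moreover have "1 / (1 + \<kappa>) * ((1 + \<kappa>) * a) = a"
        using \<kappa> by simp
      ultimately show ?thesis
        unfolding in_segment using \<kappa>
        by (intro exI[of _ "1 / (1 + \<kappa>)"]) (simp only: scaleR_scaleR, simp)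
    qed
    moreover from this have "collinear {x, ?y, ?z}"
      by (intro collinear_subset[OF collinear_closed_segment[of x ?z]]) simp
    moreover have "norm (?y - x) = a"
      using a by (simp add: norm_unit_dir)
    moreover have "?z - ?y = (\<kappa> * a) *\<^sub>R unit_dir \<theta>"
      by (simp add: algebra_simps)
    then have "norm (?z - ?y) = \<kappa> * a"
      using a \<kappa> by (simp add: norm_unit_dir)
    ultimately show False using contra by blast
  qed

  (* The gain \<epsilon> * (2 * R)\<^sup>2 has to beat the boundary terms, which amount to less than
     4 * 6 * R * D; this dictates the choice of R. *)
  define D where "D = (1 + \<kappa>) * a"
  define R where "R = 7 * D / \<epsilon>"
  have D: "D > 0" using a \<kappa> by (simp add: D_def)
  have aD: "a \<le> D" using a \<kappa> by (simp add: D_def algebra_simps)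
  have \<epsilon>R: "\<epsilon> * R = 7 * D" using \<epsilon> by (simp add: R_def)
  have RD: "R \<ge> D"
    using \<epsilon> D by (simp add: R_def pos_le_divide_eq)
  define f where "f = signed_indicator (S \<inter> cube R) (T \<inter> cube R)"
  have ST: "S \<inter> cube R \<in> sets borel" "bounded (S \<inter> cube R)"
    "T \<inter> cube R \<in> sets borel" "bounded (T \<inter> cube R)"
    using S T bounded_subset[OF bounded_cube Int_lower2] by auto
  have disj: "S \<inter> T = {}" using col S T by auto
  have cont: "continuous_on UNIV (autocorr f)"
    unfolding f_def by (intro continuous_on_autocorr ST)
  have f1: "\<bar>f x\<bar> \<le> 1" for x
    unfolding f_def by (rule abs_signed_indicator_le)
  have int_f: "integrable lborel f"
    unfolding f_def by (intro integrable_signed_indicator ST)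

  (* The signed measure to test against: the point mass at 0 with weight 1 - \<epsilon>, written as a circle
     of radius 0, and the circles of radii a, \<kappa> * a and (1 + \<kappa>) * a. By the choice of \<epsilon> its
     Fourier transform is nonnegative. *)
  define c :: "nat \<Rightarrow> real" where "c i = (if i = 0 then 1 - \<epsilon> else 1)" for i
  define r where "r i = [0, a, \<kappa> * a, (1 + \<kappa>) * a] ! i" for i
  have V: "(\<lambda>\<theta>. t *\<^sub>R unit_dir \<theta>) \<in> borel_measurable angle_measure" for t
    by (intro measurable_angle borel_measurable_scaleR borel_measurable_const unit_dir_measurable)
  have sum4: "(\<Sum>i\<in>{..<4}. F i) = F 0 + F 1 + F 2 + F (3::nat)" for F :: "nat \<Rightarrow> real"
    by (simp add: eval_nat_numeral)
  have vals: "c 0 = 1 - \<epsilon>" "c 1 = 1" "c 2 = 1" "c 3 = 1"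
    "r 0 = 0" "r 1 = a" "r 2 = \<kappa> * a" "r 3 = (1 + \<kappa>) * a"
    by (simp_all add: c_def r_def)
  have "(\<Sum>i\<in>{..<4}. c i * (LINT \<theta>|angle_measure. autocorr f (r i *\<^sub>R unit_dir \<theta>))) \<ge> 0"
  proof (rule autocorr_average_nonneg[OF int_f f1 cont finite_measure_angle])
    fix \<eta> :: "real ^ 2"
    have "(\<Sum>i\<in>{..<4}. c i * (LINT \<theta>|angle_measure. cos (\<eta> \<bullet> (r i *\<^sub>R unit_dir \<theta>))))
        = 2 * pi * ((1 - \<epsilon>) + ?J (a * norm \<eta>))"
    proof -
      have nn: "0 \<le> (0::real)" "0 \<le> a" "0 \<le> \<kappa> * a" "0 \<le> (1 + \<kappa>) * a"
        using a \<kappa> by simp_all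
      show ?thesis
        unfolding sum4 vals circle_average_cos[OF nn(1)] circle_average_cos[OF nn(2)]
          circle_average_cos[OF nn(3)] circle_average_cos[OF nn(4)]
        by (simp add: bessel_J0_0 algebra_simps)
    qed
    also have "\<dots> \<ge> 0"
      using gap[of "a * norm \<eta>"] a by simp
    finally show "(\<Sum>i\<in>{..<4}. c i * (LINT \<theta>|angle_measure. cos (\<eta> \<bullet> (r i *\<^sub>R unit_dir \<theta>)))) \<ge> 0" .
  qed (rule V)
  then have "0 \<le> (LINT \<theta>|angle_measure. (1 - \<epsilon>) * autocorr f 0
      + (autocorr f (a *\<^sub>R unit_dir \<theta>) + autocorr f ((\<kappa> * a) *\<^sub>R unit_dir \<theta>)
         + autocorr f (((1 + \<kappa>) * a) *\<^sub>R unit_dir \<theta>)))"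
    unfolding sum4 vals
    using integrable_autocorr_family[OF int_f f1 finite_measure_angle V]
    by (simp add: finite_measure.integrable_const[OF finite_measure_angle] mult_ac)
  also have "\<dots> \<le> (LINT \<theta>|angle_measure. (1 - \<epsilon>) * (2 * R)\<^sup>2 + ((2 * (R + D))\<^sup>2 - 2 * (2 * (R - D))\<^sup>2))"
  proof (rule integral_mono)
    fix \<theta>
    let ?u = "unit_dir \<theta>"
    have "autocorr f 0 \<le> measure lborel (cube R :: (real ^ 2) set)"
    proof -
      have "autocorr f 0 \<le> (LINT x|lborel. indicat_real (cube R :: (real ^ 2) set) x)"
        unfolding autocorr_def
      proof (rule integral_mono)
        show "integrable lborel (\<lambda>x. f x * f (x + 0))"
          by (rule integrable_autocorr_integrand[OF int_f f1])
        show "integrable lborel (indicat_real (cube R :: (real ^ 2) set))"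
          by (rule integrable_cube)
        show "f x * f (x + 0) \<le> indicat_real (cube R) x" for x
        proof (cases "x \<in> cube R")
          case True
          have "f x * f x \<le> 1"
            using f1[of x] by (simp add: abs_square_le_1 flip: power2_eq_square)
          then show ?thesis using True by simp
        qed (simp add: f_def signed_indicator_def)
      qed
      then show ?thesis by simp
    qed
    moreover have "autocorr f (a *\<^sub>R ?u) + autocorr f (D *\<^sub>R ?u - a *\<^sub>R ?u) + autocorr f (D *\<^sub>R ?u)
        \<le> measure lborel (cube (R + D) :: (real ^ 2) set) - 2 * measure lborel (cube (R - D) :: (real ^ 2) set)"
      unfolding f_def
    proof (rule autocorr_triple_le[where N = "NA' \<union> NB'"])
      show "- (S \<union> T) \<subseteq> NA' \<union> NB'" using col(3) S T by auto
      show "\<not> {x, x + a *\<^sub>R ?u, x + D *\<^sub>R ?u} \<subseteq> S" "\<not> {x, x + a *\<^sub>R ?u, x + D *\<^sub>R ?u} \<subseteq> T" for x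
        using no[of x \<theta>] S(1) T(1) unfolding D_def monochromatic_def by blast+
      show "norm (a *\<^sub>R ?u) \<le> D" "norm (D *\<^sub>R ?u) \<le> D"
        using a \<kappa> D aD by (simp_all add: norm_unit_dir)
    qed (use S T disj in auto)
    moreover have "D *\<^sub>R ?u - a *\<^sub>R ?u = (\<kappa> * a) *\<^sub>R ?u"
      by (simp add: D_def algebra_simps)
    ultimately show "(1 - \<epsilon>) * autocorr f 0 + (autocorr f (a *\<^sub>R ?u) + autocorr f ((\<kappa> * a) *\<^sub>R ?u)
         + autocorr f (((1 + \<kappa>) * a) *\<^sub>R ?u))
       \<le> (1 - \<epsilon>) * (2 * R)\<^sup>2 + ((2 * (R + D))\<^sup>2 - 2 * (2 * (R - D))\<^sup>2)"
      using \<epsilon> RD D by (intro add_mono mult_left_mono) (simp_all add: measure_cube D_def)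
  qed (use integrable_autocorr_family[OF int_f f1 finite_measure_angle V] in
        \<open>simp_all add: finite_measure.integrable_const[OF finite_measure_angle]\<close>)
  also have "\<dots> = 2 * pi * ((1 - \<epsilon>) * (2 * R)\<^sup>2 + ((2 * (R + D))\<^sup>2 - 2 * (2 * (R - D))\<^sup>2))"
    using measure_angle by simp
  finally have "0 \<le> (1 - \<epsilon>) * (2 * R)\<^sup>2 + ((2 * (R + D))\<^sup>2 - 2 * (2 * (R - D))\<^sup>2)"
    using pi_gt_zero by (simp only: zero_le_mult_iff) linarith
  also have "\<dots> = 4 * (6 * R * D - D\<^sup>2 - (\<epsilon> * R) * R)"
    by (simp add: power2_eq_square algebra_simps)
  also have "\<dots> = - 4 * (R * D + D\<^sup>2)"
    unfolding \<epsilon>R by (simp add: algebra_simps)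
  also have "\<dots> < 0"
  proof -
    have "R * D + D\<^sup>2 > 0"
      using D RD by (intro add_pos_pos mult_pos_pos) simp_all
    then show ?thesis by (rule mult_neg_pos[rotated]) simp
  qed
  finally show False by simp
qed

end
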